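(* The group $\mathbb Z_3^8$ is not a CI-group. Moreover, no group containing a subgroup isomorphic to $\mathbb Z_3^8$ is a CI-group. In particular, $\mathbb Z_3^n$ is not a CI-group for any $n \ge 8$.
   Context: For a group $G$ and a subset $S\subseteq G$ with $S=S^{-1}$, the Cayley graph $\mathrm{Cay}(G,S)$ is the undirected graph with vertex set $G$ in which $g$ and $h$ are adjacent if and only if $hg^{-1}\in S$. The Cayley graph $\mathrm{Cay}(G,S)$ has the CI (Cayley Isomorphism) property if for every Cayley graph $\mathrm{Cay}(G,T)$ (with $T=T^{-1}\subseteq G$) that is isomorphic to $\mathrm{Cay}(G,S)$ as a graph, there is a group automorphism $\alpha$ of $G$ such that $S^\alpha=T$, where $S^\alpha$ denotes the image of $S$ under $\alpha$. A group $G$ is a CI-group if every Cayley graph on $G$ (with undirected edges, i.e. with $S=S^{-1}$) has the CI property. *)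

theory Defs
  imports
    "HOL-Algebra.Algebra"
    "Graph_Theory.Pair_Digraph"
    "Graph_Theory.Digraph_Isomorphism"
begin

text \<open>
  An undirected graph is represented by its symmetric arc relation: for
  \<^term>\<open>set_inv\<^bsub>G\<^esub> S = S\<close> the arc set below is symmetric. The identity may belong to \<^term>\<open>S\<close>,
  in which case every vertex carries a loop.
\<close>

definition cayley_graph :: "('a, 'b) monoid_scheme \<Rightarrow> 'a set \<Rightarrow> 'a pair_pre_digraph" where
  "cayley_graph G S =
     \<lparr>pverts = carrier G,
      parcs = {(g, h). g \<in> carrier G \<and> h \<in> carrier G \<and> h \<otimes>\<^bsub>G\<^esub> inv\<^bsub>G\<^esub> g \<in> S}\<rparr>"

definition cayley_CI_property :: "('a, 'b) monoid_scheme \<Rightarrow> 'a set \<Rightarrow> bool" where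
  "cayley_CI_property G S \<longleftrightarrow>
     (\<forall>T. T \<subseteq> carrier G \<and> set_inv\<^bsub>G\<^esub> T = T \<and>
          digraph_iso (with_proj (cayley_graph G S)) (with_proj (cayley_graph G T)) \<longrightarrow>
          (\<exists>\<alpha> \<in> auto G. \<alpha> ` S = T))"

text \<open>That \<^term>\<open>G\<close> is a group is not part of the following predicate, so its negation asserts the
  existence of a Cayley graph without the CI property.\<close>

definition CI_group :: "('a, 'b) monoid_scheme \<Rightarrow> bool" where
  "CI_group G \<longleftrightarrow> (\<forall>S. S \<subseteq> carrier G \<and> set_inv\<^bsub>G\<^esub> S = S \<longrightarrow> cayley_CI_property G S)"

definition Z3_power :: "nat \<Rightarrow> (nat \<Rightarrow> int) monoid" where
  "Z3_power n = product_group {..<n} (\<lambda>_. integer_mod_group 3)"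

lemma group_Z3_power: "group (Z3_power n)"
  by (simp add: Z3_power_def product_group)

lemma cayley_graph_sym:
  assumes "group G" "S \<subseteq> carrier G" "set_inv\<^bsub>G\<^esub> S = S"
  shows "sym (parcs (cayley_graph G S))"
proof (rule symI)
  interpret group G by fact
  fix g h assume "(g, h) \<in> parcs (cayley_graph G S)"
  then have gh: "g \<in> carrier G" "h \<in> carrier G" "h \<otimes>\<^bsub>G\<^esub> inv\<^bsub>G\<^esub> g \<in> S"
    by (auto simp: cayley_graph_def)
  then have "inv\<^bsub>G\<^esub> (h \<otimes>\<^bsub>G\<^esub> inv\<^bsub>G\<^esub> g) \<in> S"
    using assms(3) unfolding SET_INV_def by blast
  with gh show "(h, g) \<in> parcs (cayley_graph G S)"
    by (simp add: cayley_graph_def inv_mult_group)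
qed

text \<open>On Cayley graphs, \<^const>\<open>digraph_iso\<close> amounts to an adjacency-preserving
  bijection between the vertex sets.\<close>

lemma digraph_iso_cayley_graph_iff:
  "digraph_iso (with_proj (cayley_graph G S)) (with_proj (cayley_graph H T)) \<longleftrightarrow>
     (\<exists>f. bij_betw f (carrier G) (carrier H) \<and>
       (\<forall>x \<in> carrier G. \<forall>y \<in> carrier G.
          (x, y) \<in> parcs (cayley_graph G S) \<longleftrightarrow> (f x, f y) \<in> parcs (cayley_graph H T)))"
  (is "?L \<longleftrightarrow> ?R")
proof
  let ?C = "with_proj (cayley_graph G S)"
  assume ?L
  then obtain k where k: "pre_digraph.digraph_isomorphism ?C k"
    and eq: "with_proj (cayley_graph H T) = app_iso k ?C"
    by (auto simp: digraph_iso_def)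
  let ?f = "iso_verts k"
  have pv: "pverts (cayley_graph G S) = carrier G" "pverts (cayley_graph H T) = carrier H"
    by (simp_all add: cayley_graph_def)
  have v: "carrier H = ?f ` carrier G"
    using arg_cong[OF eq, of verts] by (simp add: pv)
  have a: "parcs (cayley_graph H T) = iso_arcs k ` parcs (cayley_graph G S)"
    using arg_cong[OF eq, of arcs] by simp
  have t: "iso_tail k = fst" "iso_head k = snd"
    using arg_cong[OF eq, of tail] arg_cong[OF eq, of head] by simp_all
  have inj: "inj_on ?f (carrier G)"
    using k by (simp add: pre_digraph.digraph_isomorphism_def pv)
  have ia: "iso_arcs k e = (?f (fst e), ?f (snd e))" if "e \<in> parcs (cayley_graph G S)" for e
    using k that by (simp add: pre_digraph.digraph_isomorphism_def t prod_eq_iff)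
  have sub: "e \<in> parcs (cayley_graph G S) \<Longrightarrow> fst e \<in> carrier G \<and> snd e \<in> carrier G" for e
    by (auto simp: cayley_graph_def)
  have "(x, y) \<in> parcs (cayley_graph G S) \<longleftrightarrow> (?f x, ?f y) \<in> parcs (cayley_graph H T)"
    if xy: "x \<in> carrier G" "y \<in> carrier G" for x y
  proof
    assume "(x, y) \<in> parcs (cayley_graph G S)"
    then show "(?f x, ?f y) \<in> parcs (cayley_graph H T)"
      using ia a by force
  next
    assume "(?f x, ?f y) \<in> parcs (cayley_graph H T)"
    then obtain e where e: "e \<in> parcs (cayley_graph G S)" "(?f x, ?f y) = iso_arcs k e"
      unfolding a by blast
    with ia have "?f x = ?f (fst e)" "?f y = ?f (snd e)" by auto
    with inj xy sub[OF e(1)] have "e = (x, y)"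
      by (auto simp: prod_eq_iff inj_on_def)
    with e show "(x, y) \<in> parcs (cayley_graph G S)" by simp
  qed
  with inj v show ?R by (auto simp: bij_betw_def)
next
  assume ?R
  then obtain f where f: "bij_betw f (carrier G) (carrier H)"
    and adj: "\<And>x y. x \<in> carrier G \<Longrightarrow> y \<in> carrier G \<Longrightarrow>
      (x, y) \<in> parcs (cayley_graph G S) \<longleftrightarrow> (f x, f y) \<in> parcs (cayley_graph H T)"
    by blast
  have inj: "inj_on f (carrier G)" and im: "f ` carrier G = carrier H"
    using f by (auto simp: bij_betw_def)
  have pv: "pverts (cayley_graph G S) = carrier G" "pverts (cayley_graph H T) = carrier H"
    by (simp_all add: cayley_graph_def)
  have subG: "parcs (cayley_graph G S) \<subseteq> carrier G \<times> carrier G"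
    and subH: "parcs (cayley_graph H T) \<subseteq> carrier H \<times> carrier H"
    by (auto simp: cayley_graph_def)
  have a: "map_prod f f ` parcs (cayley_graph G S) = parcs (cayley_graph H T)"
  proof
    show "map_prod f f ` parcs (cayley_graph G S) \<subseteq> parcs (cayley_graph H T)"
      using adj subG by auto
    show "parcs (cayley_graph H T) \<subseteq> map_prod f f ` parcs (cayley_graph G S)"
    proof
      fix e assume e: "e \<in> parcs (cayley_graph H T)"
      obtain u v where uv: "e = (u, v)" by (cases e)
      with e subH im obtain x y where "x \<in> carrier G" "y \<in> carrier G" "u = f x" "v = f y"
        by blast
      with e uv adj show "e \<in> map_prod f f ` parcs (cayley_graph G S)"
        by (auto intro!: image_eqI[of _ _ "(x, y)"])
    qed
  qed
  have injp: "inj_on (map_prod f f) (parcs (cayley_graph G S))"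
    using map_prod_inj_on[OF inj inj] subG by (rule inj_on_subset)
  let ?k = "\<lparr>iso_verts = f, iso_arcs = map_prod f f, iso_head = snd, iso_tail = fst\<rparr>"
  have "wf_digraph (with_proj (cayley_graph G S))"
    using subG by unfold_locales (auto simp: pv)
  then have "pre_digraph.digraph_isomorphism (with_proj (cayley_graph G S)) ?k"
    using inj injp by (simp add: pre_digraph.digraph_isomorphism_def pv)
  moreover have "with_proj (cayley_graph H T) = app_iso ?k (with_proj (cayley_graph G S))"
    using a im by (simp add: app_iso_def with_proj_def pv)
  ultimately show ?L by (auto simp: digraph_iso_def)
qed

end

theory Submission
  imports Defs "HOL-Library.Numeral_Type" "HOL-Library.Product_Plus"
begin

text \<open>
  Write the group as $U \oplus W$ with coordinates $(a, b, c)$ on $U = \mathbb Z_3^3$ and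
  $w$ on $W = \mathbb Z_3^5$, and consider the cubic map
  $\varphi(a, b, c) = (a^2 c, abc, b^2 c, a^2 b, a b^2)$ from $U$ to $W$. For every $u = (a, b, c)$
  with $c \neq 0$ there is a linear functional $\lambda_u$ on $W$ such that
  $\lambda_u \circ \varphi$ has constant derivative $a^2 b^2$ in direction $u$. Hence
  $(u, w) \mapsto (u, w + \varphi(u))$ is an isomorphism between the Cayley graphs whose connection
  sets consist of the $(u, w)$ with $\lambda_u(w) = 0$, respectively $\lambda_u(w) = a^2 b^2$,
  for $c \neq 0$, together with $W$ in both cases.

  An automorphism carrying the first set to the second preserves the subgroup $a = b = 0$, the
  only subgroup of order $3^6$ contained in either set, and maps no element of it with $c \neq 0$ into $W$.
  It therefore acts on $(a, b)$ by an invertible matrix $B$, and turns each $(i, j, 1, 0)$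
  into an equation between polynomials in $i$ and $j$. Summed over all $i$ and $j$, the left-hand
  side vanishes because its degree is below 4, while the right-hand side gives $(\det B)^2 = 1$.

  In a group containing $\mathbb Z_3^8$ one applies the twist in every right coset; an automorphism
  of the large group restricts to the subgroup because the connection sets generate it.
\<close>

lemma Z3_exhaust: "(x::3) = 0 \<or> x = 1 \<or> x = 2"
proof (induct x)
  case (of_int z)
  then have "z = 0 \<or> z = 1 \<or> z = 2" by auto
  then show ?case by auto
qed

lemma all_Z3: "(\<forall>x::3. P x) \<longleftrightarrow> P 0 \<and> P 1 \<and> P 2"
  by (metis Z3_exhaust)

section \<open>The twist and the two connection sets\<close>

type_synonym vec = "3 \<times> 3 \<times> 3 \<times> 3 \<times> 3 \<times> 3 \<times> 3 \<times> 3"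

lemma vec_cases:
  fixes x :: vec
  obtains a b c w1 w2 w3 w4 w5 where "x = (a, b, c, w1, w2, w3, w4, w5)"
  by (metis surj_pair)

fun twist :: "vec \<Rightarrow> vec" where
  "twist (a, b, c, w1, w2, w3, w4, w5) =
     (a, b, c, w1 + a\<^sup>2 * c, w2 + a * b * c, w3 + b\<^sup>2 * c, w4 + a\<^sup>2 * b, w5 + a * b\<^sup>2)"

text \<open>The parameter \<open>k\<close> is \<open>0\<close> for the first connection set and \<open>1\<close> for the second.\<close>

definition conn :: "3 \<Rightarrow> vec set" where
  "conn k = {(a, b, c, w1, w2, w3, w4, w5).
     if c = 0 then a = 0 \<and> b = 0
     else c * (b\<^sup>2 * w1 + a * b * w2 + a\<^sup>2 * w3) - b * w4 - a * w5 = k * a\<^sup>2 * b\<^sup>2}"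

lemma mem_conn [simp]:
  "(a, b, c, w1, w2, w3, w4, w5) \<in> conn k \<longleftrightarrow>
     (if c = 0 then a = 0 \<and> b = 0
      else c * (b\<^sup>2 * w1 + a * b * w2 + a\<^sup>2 * w3) - b * w4 - a * w5 = k * a\<^sup>2 * b\<^sup>2)"
  by (simp add: conn_def)

text \<open>Every term of the defining equation has degree 2 or 4 in the coordinates, so a global
  sign change cancels.\<close>

lemma conn_uminus: "- x \<in> conn k \<longleftrightarrow> x \<in> conn k"
  by (cases x rule: vec_cases) (simp add: algebra_simps)

lemma uminus_image_conn: "uminus ` conn k = conn k"
proof
  show "uminus ` conn k \<subseteq> conn k"
    using conn_uminus by blast
  show "conn k \<subseteq> uminus ` conn k"
  proof
    fix x assume "x \<in> conn k"
    then have "- x \<in> conn k" using conn_uminus by blast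
    then show "x \<in> uminus ` conn k" by (rule image_eqI[rotated]) simp
  qed
qed

text \<open>The left side is lambda_u applied to phi(v + u) - phi(v), for u = (a, b, c) and v = (x,
  y, z). Modulo 3 the z-terms drop out, and c^2 = 1 turns the first group into (bx - ay)^2. The last
  two terms subtract (bx - ay)^2 + 2 a^2 b^2, which leaves -2 a^2 b^2 = a^2 b^2. The proof checks
  all values.\<close>

lemma twist_diff:
  fixes a b c x y z :: 3
  assumes "c \<noteq> 0"
  shows "c * (b\<^sup>2 * ((x + a)\<^sup>2 * (z + c) - x\<^sup>2 * z) + a * b * ((x + a) * (y + b) * (z + c) - x * y * z)
      + a\<^sup>2 * ((y + b)\<^sup>2 * (z + c) - y\<^sup>2 * z))
    - b * ((x + a)\<^sup>2 * (y + b) - x\<^sup>2 * y) - a * ((x + a) * (y + b)\<^sup>2 - x * y\<^sup>2) = a\<^sup>2 * b\<^sup>2"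
proof -
  have "\<forall>a b c x y z :: 3. c \<noteq> 0 \<longrightarrow> c * (b\<^sup>2 * ((x + a)\<^sup>2 * (z + c) - x\<^sup>2 * z) + a * b * ((x + a) * (y + b) * (z + c) - x * y * z)
      + a\<^sup>2 * ((y + b)\<^sup>2 * (z + c) - y\<^sup>2 * z))
    - b * ((x + a)\<^sup>2 * (y + b) - x\<^sup>2 * y) - a * ((x + a) * (y + b)\<^sup>2 - x * y\<^sup>2) = a\<^sup>2 * b\<^sup>2"
    unfolding all_Z3 by simp
  then show ?thesis using assms by blast
qed

lemma twist_conn: "twist y - twist x \<in> conn 1 \<longleftrightarrow> y - x \<in> conn 0"
proof -
  obtain a b c w1 w2 w3 w4 w5 where d: "y - x = (a, b, c, w1, w2, w3, w4, w5)"
    by (rule vec_cases)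
  obtain p q r v1 v2 v3 v4 v5 where x: "x = (p, q, r, v1, v2, v3, v4, v5)"
    by (rule vec_cases)
  have y: "y = (p + a, q + b, r + c, v1 + w1, v2 + w2, v3 + w3, v4 + w4, v5 + w5)"
    using d x by (simp add: diff_eq_eq add.commute)
  show ?thesis
  proof (cases "c = 0")
    case True
    then show ?thesis by (simp add: x y)
  next
    case False
    \<comment> \<open>Here \<open>m\<close> stands for lambda_u of the W-part of
      \<open>y - x\<close>, and \<open>l\<close> for the contribution of the twist.\<close>
    have eq: "m + l = 1 * a\<^sup>2 * b\<^sup>2 \<longleftrightarrow> m = 0 * a\<^sup>2 * b\<^sup>2" if "l = a\<^sup>2 * b\<^sup>2" for l m
      using that by simp
    show ?thesis
      using False eq[OF twist_diff[OF False, where a = a and b = b and x = p and y = q and z = r],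
          of "c * (b\<^sup>2 * w1 + a * b * w2 + a\<^sup>2 * w3) - b * w4 - a * w5"]
      unfolding d by (simp add: x y algebra_simps)
  qed
qed

lemma bij_twist: "bij twist"
proof -
  have "inj twist"
  proof (rule injI)
    fix x y assume "twist x = twist y"
    then show "x = y"
      by (cases x rule: vec_cases, cases y rule: vec_cases) simp
  qed
  then show ?thesis by (simp add: bij_def finite_UNIV_inj_surj)
qed

text \<open>Needed to restrict an automorphism of a larger group to the embedded copy. The first
  witness is in \<open>conn 0\<close> because its W-part is 0, the second because its first two
  coordinates are 0.\<close>

lemma conn_0_generates: "\<exists>y\<in>conn 0. \<exists>z\<in>conn 0. x = y + z"
proof -
  obtain a b c w1 w2 w3 w4 w5 where x: "x = (a, b, c, w1, w2, w3, w4, w5)"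
    by (rule vec_cases)
  show ?thesis
    by (rule bexI[of _ "(a, b, 1, 0, 0, 0, 0, 0)"], rule bexI[of _ "(0, 0, c - 1, w1, w2, w3, w4, w5)"])
      (simp_all add: x)
qed

section \<open>Subgroups of order 3^6 in the connection sets\<close>

definition core :: "vec set" where "core = {0} \<times> {0} \<times> UNIV"

text \<open>The summand W of the decomposition.\<close>

definition fibre :: "vec set" where "fibre = {0} \<times> {0} \<times> {0} \<times> UNIV"

lemma mem_core [simp]: "(a, b, c, w) \<in> core \<longleftrightarrow> a = 0 \<and> b = 0"
  by (simp add: core_def)

lemma mem_fibre [simp]: "(a, b, c, w) \<in> fibre \<longleftrightarrow> a = 0 \<and> b = 0 \<and> c = 0"
  by (simp add: fibre_def)

lemma card_core: "card core = 729" and card_fibre: "card fibre = 243"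
  by (simp_all add: core_def fibre_def card_cartesian_product)

lemma core_subset_conn: "core \<subseteq> conn k"
proof
  fix x assume "x \<in> core"
  then show "x \<in> conn k" by (cases x rule: vec_cases) simp
qed

lemma core_diff: "x \<in> core \<Longrightarrow> y \<in> core \<Longrightarrow> x - y \<in> core"
  by (cases x rule: vec_cases, cases y rule: vec_cases) simp

text \<open>On \<open>M\<close> the projection to the third coordinate has kernel
  \<open>M \<inter> fibre\<close>, so the order 3^6 forces \<open>fibre \<subseteq> M\<close>. Then
  \<open>M\<close> is a union of cosets of W. For c \<noteq> 0 this makes lambda_u constant on W,
  hence zero, and so a = b = 0.\<close>

lemma subgroup_of_conn_eq_core:
  assumes sub: "M \<subseteq> conn k" and diff: "\<And>x y. x \<in> M \<Longrightarrow> y \<in> M \<Longrightarrow> x - y \<in> M"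
    and card: "card M = 729"
  shows "M = core"
proof -
  define h :: "vec \<Rightarrow> 3" where "h = fst \<circ> snd \<circ> snd"
  have h_diff: "h (x - y) = h x - h y" for x y by (simp add: h_def)
  have bot: "x \<in> fibre" if "x \<in> M" "h x = 0" for x
    using that sub by (cases x rule: vec_cases) (auto simp: h_def)
  have "\<not> M \<subseteq> fibre"
    using card_mono[of fibre M] card card_fibre by auto
  then obtain t where t: "t \<in> M" "h t \<noteq> 0" using bot by blast
  have z: "0 \<in> M" using diff[OF t(1) t(1)] by simp
  have add: "x + y \<in> M" if "x \<in> M" "y \<in> M" for x y
    using diff[OF that(1) diff[OF z that(2)]] by simp
  let ?D = "{0, t, t + t}"
  have "M \<subseteq> (\<lambda>(y, d). y + d) ` ((M \<inter> fibre) \<times> ?D)"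
  proof
    fix x assume x: "x \<in> M"
    have "h x = 0 \<or> h x = h t \<or> h x = h t + h t"
      using Z3_exhaust[of "h x"] Z3_exhaust[of "h t"] t(2) by auto
    then have "h x = h 0 \<or> h x = h t \<or> h x = h (t + t)" by (simp add: h_def)
    then obtain d where d: "d \<in> ?D" "h x = h d" by blast
    then have "d \<in> M" using t z add by blast
    with x have "x - d \<in> M" by (rule diff)
    moreover have "h (x - d) = 0" using d by (simp add: h_diff)
    ultimately show "x \<in> (\<lambda>(y, d). y + d) ` ((M \<inter> fibre) \<times> ?D)"
      using bot d by (intro image_eqI[of _ _ "(x - d, d)"]) auto
  qed
  then have "card M \<le> card ((M \<inter> fibre) \<times> ?D)"
    by (intro surj_card_le) auto
  also have "\<dots> = card (M \<inter> fibre) * card ?D" by (rule card_cartesian_product)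
  also have "\<dots> \<le> card (M \<inter> fibre) * 3"
    by (intro mult_left_mono) (auto simp: card_insert_if)
  finally have "card fibre \<le> card (M \<inter> fibre)" using card card_fibre by simp
  then have "M \<inter> fibre = fibre" by (intro card_seteq) auto
  then have W: "w \<in> M" if "w \<in> fibre" for w using that by blast
  have "M \<subseteq> core"
  proof
    fix x assume x: "x \<in> M"
    obtain a b c w1 w2 w3 w4 w5 where xe: "x = (a, b, c, w1, w2, w3, w4, w5)"
      by (rule vec_cases)
    have "x + w \<in> conn k" if "w \<in> fibre" for w
      using sub add[OF x W[OF that]] by blast
    \<comment> \<open>The unit vectors for w4 and w5 change the defining form by -b and -a, so both
      must vanish.\<close>
    from this[of 0] this[of "(0, 0, 0, 0, 0, 0, 1, 0)"] this[of "(0, 0, 0, 0, 0, 0, 0, 1)"]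
    show "x \<in> core"
      by (auto simp: xe fibre_def zero_prod_def algebra_simps split: if_splits)
  qed
  then show ?thesis by (intro card_seteq) (simp_all add: card card_core)
qed

section \<open>Determinants and power sums over Z_3\<close>

lemma Z3_det_nonzero:
  fixes p q r s :: 3
  assumes "\<And>i j. p * i + q * j = 0 \<and> r * i + s * j = 0 \<Longrightarrow> i = 0 \<and> j = 0"
  shows "p * s - q * r \<noteq> 0"
proof
  assume d: "p * s - q * r = 0"
  have "p * s = q * r" using d by simp
  \<comment> \<open>If the determinant vanishes, (-q, p) and (s, -r) lie in the kernel. So all
    entries are 0, and then (1, 1) is in the kernel too.\<close>
  then have *: "p * - q + q * p = 0 \<and> r * - q + s * p = 0" "p * s + q * - r = 0 \<and> r * s + s * - r = 0"
    by (simp_all add: mult.commute)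
  have "- q = 0 \<and> p = 0" "s = 0 \<and> - r = 0"
    by (rule assms[OF *(1)], rule assms[OF *(2)])
  then show False using assms[of 1 1] by simp
qed

lemma Z3_six: "(6 :: 3) = 0" by simp

text \<open>Summed over Z_3^2, the monomial i^m j^n gives 0 unless m and n are both positive and
  even. A polynomial of degree at most 3 therefore sums to 0, and a quartic form to its coefficient
  of i^2 j^2, which on the right is p^2 s^2 + 4pqrs + q^2 r^2 = (ps - qr)^2.\<close>

lemma moment_contradiction:
  fixes p q r s e l1 l2 l3 l4 l5 m1 m2 m3 m4 m5 n1 n2 n3 n4 n5 :: 3
  assumes "p * s - q * r \<noteq> 0"
    and eq: "\<And>i j. e * ((r * i + s * j)\<^sup>2 * (l1 * i + m1 * j + n1)
        + (p * i + q * j) * (r * i + s * j) * (l2 * i + m2 * j + n2)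
        + (p * i + q * j)\<^sup>2 * (l3 * i + m3 * j + n3))
      - (r * i + s * j) * (l4 * i + m4 * j + n4) - (p * i + q * j) * (l5 * i + m5 * j + n5)
      = (p * i + q * j)\<^sup>2 * (r * i + s * j)\<^sup>2"
  shows False
proof -
  have "(\<Sum>i\<in>{0,1,-1}. \<Sum>j\<in>{0,1,-1}. (p * i + q * j)\<^sup>2 * (r * i + s * j)\<^sup>2)
     = (\<Sum>i\<in>{0,1,-1}. \<Sum>j\<in>{0,1,-1}. e * ((r * i + s * j)\<^sup>2 * (l1 * i + m1 * j + n1)
        + (p * i + q * j) * (r * i + s * j) * (l2 * i + m2 * j + n2)
        + (p * i + q * j)\<^sup>2 * (l3 * i + m3 * j + n3))
      - (r * i + s * j) * (l4 * i + m4 * j + n4) - (p * i + q * j) * (l5 * i + m5 * j + n5))"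
    unfolding eq ..
  also have "\<dots> = 0"
    by (simp add: Z3_six algebra_simps power2_eq_square)
  finally have "(\<Sum>i\<in>{0,1,-1}. \<Sum>j\<in>{0,1,-1}. (p * i + q * j)\<^sup>2 * (r * i + s * j)\<^sup>2) = 0" .
  moreover have "(\<Sum>i\<in>{0,1,-1}. \<Sum>j\<in>{0,1,-1}. (p * i + q * j)\<^sup>2 * (r * i + s * j)\<^sup>2) = (p * s - q * r)\<^sup>2"
  proof -
    have "\<forall>p q r s :: 3. (\<Sum>i\<in>{0,1,-1}. \<Sum>j\<in>{0,1,-1}. (p * i + q * j)\<^sup>2 * (r * i + s * j)\<^sup>2) = (p * s - q * r)\<^sup>2"
      unfolding all_Z3 by simp
    then show ?thesis by blast
  qed
  moreover have "\<forall>d :: 3. d \<noteq> 0 \<longrightarrow> d\<^sup>2 \<noteq> 0" unfolding all_Z3 by simp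
  ultimately show False using assms(1) by metis
qed

section \<open>No linear bijection carries one connection set to the other\<close>

definition scale :: "3 \<Rightarrow> vec \<Rightarrow> vec" where
  "scale k = (\<lambda>(a, b, c, w1, w2, w3, w4, w5). (k * a, k * b, k * c, k * w1, k * w2, k * w3, k * w4, k * w5))"

lemma scale_simps: "scale 0 x = 0" "scale 1 x = x" "scale 2 x = x + x"
  by (cases x rule: vec_cases; simp add: scale_def zero_prod_def algebra_simps)+

text \<open>Over a prime field additive maps are linear, since every scalar is a repeated sum of
  1.\<close>

lemma additive_scale:
  assumes "\<And>x y. \<alpha> (x + y) = \<alpha> x + \<alpha> y"
  shows "\<alpha> (scale k x) = scale k (\<alpha> x)"
proof -
  have "\<alpha> 0 = 0" using assms[of 0 0] by simp
  then show ?thesis using Z3_exhaust[of k] by (auto simp: scale_simps assms)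
qed

lemma no_additive_map:
  fixes \<alpha> :: "vec \<Rightarrow> vec"
  assumes add: "\<And>x y. \<alpha> (x + y) = \<alpha> x + \<alpha> y" and inj: "inj \<alpha>"
    and im: "\<alpha> ` conn 0 = conn 1"
  shows False
proof -
  have diff: "\<alpha> (x - y) = \<alpha> x - \<alpha> y" for x y using add[of "x - y" y] by simp
  have "\<alpha> ` core = core"
  proof (rule subgroup_of_conn_eq_core)
    show "\<alpha> ` core \<subseteq> conn 1" using im core_subset_conn by blast
    show "x - y \<in> \<alpha> ` core" if "x \<in> \<alpha> ` core" "y \<in> \<alpha> ` core" for x y
      using that core_diff by (auto simp flip: diff)
    show "card (\<alpha> ` core) = 729"
      using inj by (simp add: card_image card_core inj_on_subset)
  qed
  then have core_iff: "\<alpha> x \<in> core \<longleftrightarrow> x \<in> core" for x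
    using inj by (metis inj_image_mem_iff)
  have conn_iff: "\<alpha> x \<in> conn 1 \<longleftrightarrow> x \<in> conn 0" for x
    using inj im by (metis inj_image_mem_iff)
  have "bij \<alpha>" using inj by (simp add: bij_def finite_UNIV_inj_surj)
  define \<beta> where "\<beta> = inv_into UNIV \<alpha>"
  have \<alpha>\<beta>: "\<alpha> (\<beta> x) = x" and \<beta>\<alpha>: "\<beta> (\<alpha> x) = x" for x
    using \<open>bij \<alpha>\<close> by (simp_all add: \<beta>_def bij_is_inj bij_is_surj surj_f_inv_f)
  have \<beta>_add: "\<beta> (x + y) = \<beta> x + \<beta> y" for x y
    by (metis \<alpha>\<beta> \<beta>\<alpha> add)
  define h :: "vec \<Rightarrow> 3" where "h = fst \<circ> snd \<circ> snd"
  have h_add: "h (x + y) = h x + h y" for x y by (simp add: h_def)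
  have h_nz: "h x \<noteq> 0" if "x \<in> conn k" "x \<notin> core" for x k
    using that by (cases x rule: vec_cases) (auto simp: h_def)
  have h\<beta>: "h (\<beta> x) \<noteq> 0" if "x \<in> conn 1" "x \<notin> core" for x
    using that h_nz[of "\<beta> x" 0] conn_iff[of "\<beta> x"] core_iff[of "\<beta> x"] by (simp add: \<alpha>\<beta>)
  \<comment> \<open>Were \<open>h (\<beta> w)\<close> nonzero, the values of
    \<open>h \<circ> \<beta>\<close> at \<open>t\<close>, \<open>t + w\<close> and
    \<open>t + w + w\<close> would exhaust Z_3, but none of them is 0.\<close>
  have h\<beta>0: "h (\<beta> w) = 0"
    if "t \<in> conn 1 - core" "t + w \<in> conn 1 - core" "t + w + w \<in> conn 1 - core" for t w
    using h\<beta>[of t] h\<beta>[of "t + w"] h\<beta>[of "t + w + w"] that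
      Z3_exhaust[of "h (\<beta> t)"] Z3_exhaust[of "h (\<beta> w)"]
    by (auto simp: \<beta>_add h_add)
  \<comment> \<open>For u = (1, 0, 1) the functional lambda_u is w3 - w5, and for u = (0, 1, 1) it
    is w1 - w4. The chosen directions lie in these kernels, and the constant a^2 b^2 is 0 at both
    points.\<close>
  have w: "h (\<beta> (0, 0, 0, 1, 0, 0, 0, 0)) = 0" "h (\<beta> (0, 0, 0, 0, 1, 0, 0, 0)) = 0"
    "h (\<beta> (0, 0, 0, 0, 0, 0, 1, 0)) = 0" "h (\<beta> (0, 0, 0, 0, 0, 1, 0, 1)) = 0"
    "h (\<beta> (0, 0, 0, 0, 0, 1, 0, 0)) = 0"
    using h\<beta>0[of "(1, 0, 1, 0)" "(0, 0, 0, 1, 0, 0, 0, 0)"]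
      h\<beta>0[of "(1, 0, 1, 0)" "(0, 0, 0, 0, 1, 0, 0, 0)"]
      h\<beta>0[of "(1, 0, 1, 0)" "(0, 0, 0, 0, 0, 0, 1, 0)"]
      h\<beta>0[of "(1, 0, 1, 0)" "(0, 0, 0, 0, 0, 1, 0, 1)"]
      h\<beta>0[of "(0, 1, 1, 0)" "(0, 0, 0, 0, 0, 1, 0, 0)"]
    by (simp_all add: zero_prod_def)
  have w5: "h (\<beta> (0, 0, 0, 0, 0, 0, 0, 1)) = 0"
    using w(4,5) \<beta>_add[of "(0, 0, 0, 0, 0, 1, 0, 0)" "(0, 0, 0, 0, 0, 0, 0, 1)"]
    by (simp add: h_add)
  have h_scale: "h (scale k x) = k * h x" for k x
    by (cases x rule: vec_cases) (simp add: h_def scale_def)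
  have bot: "h (\<beta> x) = 0" if "x \<in> fibre" for x
  proof -
    obtain a b c w1 w2 w3 w4 w5 where x: "x = (a, b, c, w1, w2, w3, w4, w5)"
      by (rule vec_cases)
    with that have "a = 0" "b = 0" "c = 0" by simp_all
    then have "x = scale w1 (0, 0, 0, 1, 0, 0, 0, 0) + (scale w2 (0, 0, 0, 0, 1, 0, 0, 0)
      + (scale w3 (0, 0, 0, 0, 0, 1, 0, 0) + (scale w4 (0, 0, 0, 0, 0, 0, 1, 0)
      + scale w5 (0, 0, 0, 0, 0, 0, 0, 1))))"
      by (simp add: x scale_def)
    then show ?thesis
      by (simp only: \<beta>_add h_add additive_scale[OF \<beta>_add] h_scale w w5) simp
  qed
  obtain p r g l1 l2 l3 l4 l5 where A: "\<alpha> (1, 0, 0, 0) = (p, r, g, l1, l2, l3, l4, l5)"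
    by (rule vec_cases)
  obtain q s g' m1 m2 m3 m4 m5 where B: "\<alpha> (0, 1, 0, 0) = (q, s, g', m1, m2, m3, m4, m5)"
    by (rule vec_cases)
  obtain e n1 n2 n3 n4 n5 where C: "\<alpha> (0, 0, 1, 0) = (0, 0, e, n1, n2, n3, n4, n5)"
  proof -
    obtain a b c n1 n2 n3 n4 n5 where c: "\<alpha> (0, 0, 1, 0) = (a, b, c, n1, n2, n3, n4, n5)"
      by (rule vec_cases)
    then show ?thesis using core_iff[of "(0, 0, 1, 0)"] that by simp
  qed
  \<comment> \<open>Otherwise (0, 0, 1, 0) would be mapped into W, against
    \<open>bot\<close>.\<close>
  have e: "e \<noteq> 0"
  proof
    assume "e = 0"
    then have "h (\<beta> (\<alpha> (0, 0, 1, 0))) = 0" using bot by (simp add: C)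
    then show False by (simp add: \<beta>\<alpha> h_def)
  qed
  have val: "\<alpha> (i, j, k, 0) = (p * i + q * j, r * i + s * j, g * i + g' * j + e * k,
      l1 * i + m1 * j + n1 * k, l2 * i + m2 * j + n2 * k, l3 * i + m3 * j + n3 * k,
      l4 * i + m4 * j + n4 * k, l5 * i + m5 * j + n5 * k)" for i j k
  proof -
    have "(i, j, k, 0) = scale i (1, 0, 0, 0) + (scale j (0, 1, 0, 0) + scale k (0, 0, 1, 0))"
      by (simp add: scale_def zero_prod_def)
    then show ?thesis
      by (simp only: add additive_scale[OF add] A B C) (simp add: scale_def algebra_simps)
  qed
  have nz: "g * i + g' * j + e * k \<noteq> 0" if "k \<noteq> 0" "i \<noteq> 0 \<or> j \<noteq> 0" for i j k
  proof -
    have "(i, j, k, 0) \<in> conn 0" "(i, j, k, 0) \<notin> core"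
      using that by (auto simp: zero_prod_def)
    then have "h (\<alpha> (i, j, k, 0)) \<noteq> 0"
      using conn_iff core_iff h_nz by blast
    then show ?thesis by (simp add: val h_def)
  qed
  \<comment> \<open>By \<open>nz\<close>, neither \<open>g\<close> nor \<open>g'\<close> equals e or
    -e, the two nonzero elements. Hence the third coordinate of \<open>\<alpha> (i, j, 1, 0)\<close>
    is the constant \<open>e\<close>, which keeps the degree in i and j at most 3.\<close>
  have "g = 0" "g' = 0"
    using nz[of 1 1 0] nz[of 2 1 0] nz[of 1 0 1] nz[of 2 0 1] e
      Z3_exhaust[of g] Z3_exhaust[of g'] Z3_exhaust[of e] by auto
  have "p * s - q * r \<noteq> 0"
  proof (rule Z3_det_nonzero)
    fix i j assume "p * i + q * j = 0 \<and> r * i + s * j = 0"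
    then have "\<alpha> (i, j, 0, 0) \<in> core" by (simp add: val)
    then show "i = 0 \<and> j = 0" by (simp add: core_iff)
  qed
  then show False
  proof (rule moment_contradiction)
    fix i j
    have "(i, j, 1, 0) \<in> conn 0" by (simp add: zero_prod_def)
    then have "\<alpha> (i, j, 1, 0) \<in> conn 1" by (simp only: conn_iff)
    then show "e * ((r * i + s * j)\<^sup>2 * (l1 * i + m1 * j + n1)
        + (p * i + q * j) * (r * i + s * j) * (l2 * i + m2 * j + n2)
        + (p * i + q * j)\<^sup>2 * (l3 * i + m3 * j + n3))
      - (r * i + s * j) * (l4 * i + m4 * j + n4)
      - (p * i + q * j) * (l5 * i + m5 * j + n5)
      = (p * i + q * j)\<^sup>2 * (r * i + s * j)\<^sup>2"
      using e by (simp add: val \<open>g = 0\<close> \<open>g' = 0\<close>)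
  qed
qed

section \<open>Twisting the right cosets of an embedded copy\<close>

definition vec_group :: "vec monoid" where
  "vec_group = \<lparr>carrier = UNIV, monoid.mult = (+), one = 0\<rparr>"

lemma not_CI_group_if_embeds:
  fixes G (structure)
  assumes "group G" and h: "h \<in> hom vec_group G" and inj: "inj h"
  shows "\<not> CI_group G"
proof
  assume CI: "CI_group G"
  interpret group G by fact
  have hc [simp]: "h x \<in> carrier G" and h_add: "h (x + y) = h x \<otimes> h y" for x y
    using hom_in_carrier[OF h, of x] hom_mult[OF h, of x y] by (simp_all add: vec_group_def)
  have h0: "h 0 = \<one>" using h_add[of 0 0] hc[of 0] by (metis add_0 r_cancel_one')
  have h_minus: "h (- x) = inv (h x)" for x
    using h_add[of "- x" x] h0 by (simp add: inv_equality)
  have h_diff: "h (x - y) = h x \<otimes> inv (h y)" for x y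
    using h_add[of x "- y"] by (simp add: h_minus)
  have h_eq: "h x = h y \<longleftrightarrow> x = y" for x y using inj by (rule inj_eq)
  have inv_conn: "set_inv (h ` conn k) = h ` conn k" for k
  proof -
    have "set_inv (h ` conn k) = h ` uminus ` conn k"
      unfolding SET_INV_def by (simp only: UNION_singleton_eq_range image_image h_minus)
    then show ?thesis by (simp only: uminus_image_conn)
  qed
  define rel where "rel x y \<longleftrightarrow> y \<otimes> inv x \<in> range h" for x y
  \<comment> \<open>The predicate under \<open>SOME\<close> depends only on the right coset of
    \<open>x\<close>, so all elements of a coset get the same representative.\<close>
  define rep where "rep x = (SOME t. t \<in> carrier G \<and> rel t x)" for x
  have rep: "rep x \<in> carrier G" "rel (rep x) x" if "x \<in> carrier G" for x
  proof -
    have "x \<in> carrier G \<and> rel x x" using that h0 by (auto simp: rel_def intro: range_eqI[of _ _ 0])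
    then have "rep x \<in> carrier G \<and> rel (rep x) x" unfolding rep_def by (rule someI)
    then show "rep x \<in> carrier G" "rel (rep x) x" by auto
  qed
  have dec: "\<exists>v. x = h v \<otimes> rep x" if x: "x \<in> carrier G" for x
  proof -
    obtain v where "h v = x \<otimes> inv (rep x)" using rep(2)[OF x] by (auto simp: rel_def)
    then show ?thesis using inv_solve_right[OF hc x rep(1)[OF x]] by blast
  qed
  have rel_h: "rel t (h v \<otimes> x) \<longleftrightarrow> rel t x" if "t \<in> carrier G" "x \<in> carrier G" for t x v
  proof
    assume "rel t x"
    then obtain u where "x \<otimes> inv t = h u" by (auto simp: rel_def)
    then have "h v \<otimes> x \<otimes> inv t = h (v + u)" using that by (simp add: h_add m_assoc)
    then show "rel t (h v \<otimes> x)" by (auto simp: rel_def)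
  next
    assume "rel t (h v \<otimes> x)"
    then obtain u where u: "h v \<otimes> x \<otimes> inv t = h u" by (auto simp: rel_def)
    have "x \<otimes> inv t = inv (h v) \<otimes> (h v \<otimes> x \<otimes> inv t)"
      using that by (simp add: m_assoc[symmetric])
    also have "\<dots> = h (- v + u)" by (simp only: u h_add h_minus)
    finally show "rel t x" by (auto simp: rel_def)
  qed
  have rep_h: "rep (h v \<otimes> x) = rep x" if "x \<in> carrier G" for v x
    unfolding rep_def using that rel_h by (metis (no_types, lifting))
  have rep_rep: "rep (rep x) = rep x" if "x \<in> carrier G" for x
    using dec[OF that] rep_h rep(1)[OF that] by metis
  define crd where "crd x = (SOME v. x = h v \<otimes> rep x)" for x
  have crd: "x = h (crd x) \<otimes> rep x" if "x \<in> carrier G" for x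
    unfolding crd_def using dec[OF that] by (rule someI_ex)
  define F where "F x = h (twist (crd x)) \<otimes> rep x" for x
  have crd_h: "crd (h v \<otimes> rep x) = v" if "x \<in> carrier G" for v x
  proof -
    have "h v \<otimes> rep x = h (crd (h v \<otimes> rep x)) \<otimes> rep x"
      using crd[of "h v \<otimes> rep x"] rep_h[of "rep x" v] rep_rep[OF that] rep(1)[OF that] by simp
    then show ?thesis using rep(1)[OF that] by (simp add: h_eq)
  qed
  have Fc: "F x \<in> carrier G" and rep_F: "rep (F x) = rep x" if "x \<in> carrier G" for x
    using that rep rep_h rep_rep by (auto simp: F_def)
  have "bij_betw F (carrier G) (carrier G)"
  proof (rule bij_betwI)
    let ?F' = "\<lambda>x. h (inv_into UNIV twist (crd x)) \<otimes> rep x"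
    show "F \<in> carrier G \<rightarrow> carrier G" using Fc by blast
    show "?F' \<in> carrier G \<rightarrow> carrier G" using rep by auto
    show "?F' (F x) = x" if "x \<in> carrier G" for x
      using crd_h[OF that] rep_F[OF that] crd[OF that] bij_twist
      by (simp add: F_def bij_is_inj)
    show "F (?F' x) = x" if "x \<in> carrier G" for x
      using crd_h[OF that] rep_h[of "rep x"] rep_rep[OF that] rep(1)[OF that] crd[OF that] bij_twist
      by (simp add: F_def bij_is_surj surj_f_inv_f)
  qed
  moreover have "(x, y) \<in> parcs (cayley_graph G (h ` conn 0)) \<longleftrightarrow>
      (F x, F y) \<in> parcs (cayley_graph G (h ` conn 1))"
    if x: "x \<in> carrier G" and y: "y \<in> carrier G" for x y
  \<comment> \<open>Within a coset the representative cancels from the quotient, leaving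
    \<open>twist_conn\<close>. Across cosets there are no edges, because both connection sets lie in
    \<open>range h\<close>.\<close>
  proof (cases "rep x = rep y")
    case True
    have *: "h v \<otimes> rep x \<otimes> inv (h u \<otimes> rep x) = h (v - u)" for u v
    proof -
      have "rep x \<otimes> (inv (rep x) \<otimes> inv (h u)) = inv (h u)"
        using rep(1)[OF x] by (simp add: m_assoc[symmetric])
      then show ?thesis using rep(1)[OF x] by (simp add: h_diff inv_mult_group m_assoc)
    qed
    have "y \<otimes> inv x = h (crd y - crd x)"
      using crd[OF x] crd[OF y] True * by metis
    moreover have "F y \<otimes> inv (F x) = h (twist (crd y) - twist (crd x))"
      using True * by (simp add: F_def)
    ultimately show ?thesis
      using x y Fc twist_conn by (simp add: cayley_graph_def inj_image_mem_iff[OF inj])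
  next
    case False
    have *: "v \<otimes> inv u \<notin> range h" if "u \<in> carrier G" "v \<in> carrier G" "rep u \<noteq> rep v" for u v
    proof
      assume "v \<otimes> inv u \<in> range h"
      then obtain z where "h z = v \<otimes> inv u" by fastforce
      then have "v = h z \<otimes> u" using inv_solve_right[OF hc that(2,1)] by blast
      then show False using that rep_h[OF that(1), of z] by simp
    qed
    show ?thesis
      using *[OF x y False] *[OF Fc[OF x] Fc[OF y]] False rep_F x y
      by (auto simp: cayley_graph_def)
  qed
  ultimately have "digraph_iso (with_proj (cayley_graph G (h ` conn 0))) (with_proj (cayley_graph G (h ` conn 1)))"
    unfolding digraph_iso_cayley_graph_iff by blast
  moreover have "h ` conn k \<subseteq> carrier G" for k by auto
  ultimately obtain \<alpha> where \<alpha>: "\<alpha> \<in> auto G" "\<alpha> ` (h ` conn 0) = h ` conn 1"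
    using CI inv_conn unfolding CI_group_def cayley_CI_property_def by metis
  have \<alpha>_mult: "\<alpha> (x \<otimes> y) = \<alpha> x \<otimes> \<alpha> y" if "x \<in> carrier G" "y \<in> carrier G" for x y
    using \<alpha>(1) that by (auto simp: auto_def hom_def)
  have \<alpha>_inj: "inj_on \<alpha> (carrier G)"
    using \<alpha>(1) by (auto simp: auto_def Bij_def bij_betw_def)
  \<comment> \<open>The image of \<open>h\<close> is mapped into itself, so \<open>\<alpha>\<close>
    pulls back to an additive map on \<open>vec\<close>.\<close>
  have "\<exists>v. \<alpha> (h x) = h v" for x
  proof -
    obtain y z where yz: "y \<in> conn 0" "z \<in> conn 0" "x = y + z"
      using conn_0_generates by blast
    then have "\<alpha> (h y) \<in> h ` conn 1" "\<alpha> (h z) \<in> h ` conn 1" using \<alpha>(2) by blast+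
    then obtain u v where "\<alpha> (h y) = h u" "\<alpha> (h z) = h v" by blast
    then have "\<alpha> (h x) = h (u + v)" by (simp add: yz(3) h_add \<alpha>_mult)
    then show ?thesis by blast
  qed
  then obtain \<gamma> where \<gamma>: "\<And>x. \<alpha> (h x) = h (\<gamma> x)" by metis
  show False
  proof (rule no_additive_map)
    show "\<gamma> (x + y) = \<gamma> x + \<gamma> y" for x y
      by (metis \<gamma> \<alpha>_mult h_add h_eq hc)
    show "inj \<gamma>"
      using \<alpha>_inj by (metis (no_types, lifting) \<gamma> h_eq hc injI inj_onD)
    have "h ` \<gamma> ` conn 0 = h ` conn 1" using \<alpha>(2) by (simp add: image_image \<gamma>)
    then show "\<gamma> ` conn 0 = conn 1" using inj by (simp add: inj_image_eq_iff)
  qed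
qed

section \<open>Embedding into Z_3^n\<close>

definition residue :: "3 \<Rightarrow> int" where
  "residue x = (if x = 0 then 0 else if x = 1 then 1 else 2)"

lemma residue_range: "residue x \<in> {0..<3}"
  by (simp add: residue_def)

lemma residue_add: "residue (x + y) = (residue x + residue y) mod 3"
  using Z3_exhaust[of x] Z3_exhaust[of y] by (auto simp: residue_def)

lemma residue_eq: "residue x = residue y \<longleftrightarrow> x = y"
  using Z3_exhaust[of x] Z3_exhaust[of y] by (auto simp: residue_def)

text \<open>The restricted abstraction makes the value extensional, as the carrier of
  \<open>product_group\<close> demands. Coordinates are padded by 0 for n > 8 and truncated for n <
  8, so this is a homomorphism for every n but injective only for n \<ge> 8.\<close>

definition vec_embed :: "nat \<Rightarrow> vec \<Rightarrow> nat \<Rightarrow> int" where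
  "vec_embed n = (\<lambda>(a, b, c, w1, w2, w3, w4, w5). \<lambda>i\<in>{..<n}.
     if i < 8 then residue ([a, b, c, w1, w2, w3, w4, w5] ! i) else 0)"

lemma embed_hom: "vec_embed n \<in> hom vec_group (Z3_power n)"
proof (rule homI)
  show "vec_embed n x \<in> carrier (Z3_power n)" for x
    using residue_range
    by (cases x rule: vec_cases)
      (auto simp: vec_embed_def Z3_power_def carrier_integer_mod_group PiE_iff)
  show "vec_embed n (x \<otimes>\<^bsub>vec_group\<^esub> y) = vec_embed n x \<otimes>\<^bsub>Z3_power n\<^esub> vec_embed n y" for x y
  proof -
    obtain a b c w1 w2 w3 w4 w5 where x: "x = (a, b, c, w1, w2, w3, w4, w5)"
      by (rule vec_cases)
    obtain a' b' c' v1 v2 v3 v4 v5 where y: "y = (a', b', c', v1, v2, v3, v4, v5)"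
      by (rule vec_cases)
    have nth: "[a + a', b + b', c + c', w1 + v1, w2 + v2, w3 + v3, w4 + v4, w5 + v5] ! i =
        [a, b, c, w1, w2, w3, w4, w5] ! i + [a', b', c', v1, v2, v3, v4, v5] ! i" if "i < 8" for i
    proof -
      have "i = 0 \<or> i = 1 \<or> i = 2 \<or> i = 3 \<or> i = 4 \<or> i = 5 \<or> i = 6 \<or> i = 7"
        using that by arith
      then show ?thesis by (elim disjE) simp_all
    qed
    show ?thesis
      by (rule ext)
        (simp add: x y vec_embed_def Z3_power_def vec_group_def nth residue_add del: nth_Cons_numeral)
  qed
qed

lemma inj_embed:
  assumes "n \<ge> 8"
  shows "inj (vec_embed n)"
proof (rule injI)
  fix x y assume eq: "vec_embed n x = vec_embed n y"
  have *: "vec_embed n x i = vec_embed n y i" for i using eq by simp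
  show "x = y"
    using *[of 0] *[of 1] *[of 2] *[of 3] *[of 4] *[of 5] *[of 6] *[of 7] assms
    by (cases x rule: vec_cases, cases y rule: vec_cases) (simp add: vec_embed_def residue_eq)
qed

theorem theorem3p11:
  shows "\<not> CI_group (Z3_power 8) \<and>
    (\<forall>(G :: ('a, 'b) monoid_scheme) H.
       group G \<and> subgroup H G \<and> G\<lparr>carrier := H\<rparr> \<cong> Z3_power 8 \<longrightarrow> \<not> CI_group G) \<and>
    (\<forall>n \<ge> 8. \<not> CI_group (Z3_power n))"
proof -
  have power: "\<not> CI_group (Z3_power n)" if "n \<ge> 8" for n
    using group_Z3_power embed_hom inj_embed[OF that] by (rule not_CI_group_if_embeds)
  have "\<not> CI_group G"
    if G: "group G" and H: "subgroup H G" and iso: "G\<lparr>carrier := H\<rparr> \<cong> Z3_power 8"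
    for G :: "('a, 'b) monoid_scheme" and H
  proof -
    have "Z3_power 8 \<cong> G\<lparr>carrier := H\<rparr>"
      using group.iso_sym[OF subgroup.subgroup_is_group[OF H G] iso] .
    then obtain k where k: "k \<in> hom (Z3_power 8) (G\<lparr>carrier := H\<rparr>)" "inj_on k (carrier (Z3_power 8))"
      by (auto simp: is_iso_def iso_def bij_betw_def)
    have "k \<in> hom (Z3_power 8) G"
      using k(1) subgroup.subset[OF H] by (auto simp: hom_def)
    then have "k \<circ> vec_embed 8 \<in> hom vec_group G"
      using embed_hom by (rule hom_compose[rotated])
    moreover have "inj (k \<circ> vec_embed 8)"
    proof (rule comp_inj_on)
      show "inj (vec_embed 8)" by (rule inj_embed) simp
      show "inj_on k (range (vec_embed 8))"
        using k(2) embed_hom[of 8] by (auto simp: hom_def vec_group_def intro: inj_on_subset)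
    qed
    ultimately show ?thesis by (rule not_CI_group_if_embeds[OF G])
  qed
  with power show ?thesis by auto
qed

end
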